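(* Consider the first-order multiagent system $\dot x=-Lx+Bu$, $y=Hx$ on a directed weighted graph (with positive edge weights) with $n$ nodes, leader set $\mathcal{V}_L$ and target set $\mathcal{V}_T$. If the system is target controllable, then each target node is reachable from the leader set. Moreover, each target node is reachable from the leader set if and only if the target controllability matrix $W=[HB,H(-L)B,\dots,H(-L)^{n-1}B]$ has no zero rows.
   Context: Graph: $\mathcal{G}$ is a simple directed weighted graph (no self-loops, no multiple edges) with nodes $v_1,\dots,v_n$; $a_{ij}=w_{ij}>0$ if there is an edge from $v_j$ to $v_i$ ($i\ne j$), and $a_{ij}=0$ otherwise. The Laplacian $L=[l_{ij}]$ has $l_{ii}=\sum_{k\neq i}a_{ik}$ and $l_{ij}=-a_{ij}$ for $i\ne j$. System: leader set $\mathcal{V}_L=\{v_1,\dots,v_l\}$, target set $\mathcal{V}_T=\{\bar v_1,\dots,\bar v_p\}\subseteq\mathcal{V}$; $B=[e_{v_1},\dots,e_{v_l}]\in\mathbb{R}^{n\times l}$, $H=[e_{\bar v_1},\dots,e_{\bar v_p}]^T\in\mathbb{R}^{p\times n}$, with $e_i$ the standard basis vector indexed by the node. The system is target controllable if for any initial state $x(t_0)\in\mathbb{R}^n$ and any $y_f\in\mathbb{R}^p$ there is a control input $u$ with $y(t_f)=y_f$ ($t_0<t_f$ finite); equivalently $W$ has rank $p$. A node is reachable from the leader set if it is a leader or there is a directed path from some leader to it. *)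

theory Defs
  imports Complex_Main "Jordan_Normal_Form.Matrix" "Graph_Theory.Pair_Digraph"
begin

text \<open>The nodes of a graph are numbered \<open>0, \<dots>, n - 1\<close>. An arc \<open>(j, i)\<close> runs from
  node \<open>j\<close> to node \<open>i\<close>, and its weight is \<open>w i j\<close> (receiving node first).\<close>

definition adj_weight :: "nat pair_pre_digraph \<Rightarrow> (nat \<Rightarrow> nat \<Rightarrow> real) \<Rightarrow> nat \<Rightarrow> nat \<Rightarrow> real" where
  "adj_weight G w i j = (if (j, i) \<in> parcs G then w i j else 0)"

definition laplacian :: "nat \<Rightarrow> nat pair_pre_digraph \<Rightarrow> (nat \<Rightarrow> nat \<Rightarrow> real) \<Rightarrow> real mat" where
  "laplacian n G w = mat n n (\<lambda>(i, j).
     if i = j then (\<Sum>k\<in>{..<n} - {i}. adj_weight G w i k) else - adj_weight G w i j)"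

definition leader_mat :: "nat \<Rightarrow> nat list \<Rightarrow> real mat" where
  "leader_mat n ls = mat_of_cols n (map (unit_vec n) ls)"

definition target_mat :: "nat \<Rightarrow> nat list \<Rightarrow> real mat" where
  "target_mat n ts = mat_of_rows n (map (unit_vec n) ts)"

text \<open>A trajectory of \<open>x' = - L x + B u\<close> on \<open>[t0, tf]\<close>: outside a finite set of switching
  times the input is continuous and the equation holds; the state is continuous throughout.
  Continuity and derivatives of vector functions are taken componentwise.\<close>

definition trajectory ::
  "real mat \<Rightarrow> real mat \<Rightarrow> real \<Rightarrow> real \<Rightarrow> (real \<Rightarrow> real vec) \<Rightarrow> (real \<Rightarrow> real vec) \<Rightarrow> bool" where
  "trajectory L B t0 tf u x \<longleftrightarrow>
     (\<forall>t\<in>{t0..tf}. u t \<in> carrier_vec (dim_col B) \<and> x t \<in> carrier_vec (dim_row L)) \<and>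
     (\<forall>i<dim_row L. continuous_on {t0..tf} (\<lambda>t. x t $ i)) \<and>
     (\<exists>D. finite D \<and>
        (\<forall>j<dim_col B. continuous_on ({t0..tf} - D) (\<lambda>t. u t $ j)) \<and>
        (\<forall>t\<in>{t0<..<tf} - D. \<forall>i<dim_row L.
           ((\<lambda>s. x s $ i) has_real_derivative (- L *\<^sub>v x t + B *\<^sub>v u t) $ i) (at t)))"

definition target_controllable :: "real \<Rightarrow> real mat \<Rightarrow> real mat \<Rightarrow> real mat \<Rightarrow> bool" where
  "target_controllable t0 L B H \<longleftrightarrow>
     (\<forall>x0\<in>carrier_vec (dim_row L). \<forall>yf\<in>carrier_vec (dim_row H).
        \<exists>tf>t0. \<exists>u x. trajectory L B t0 tf u x \<and> x t0 = x0 \<and> H *\<^sub>v x tf = yf)"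

definition target_controllability_mat :: "real mat \<Rightarrow> real mat \<Rightarrow> real mat \<Rightarrow> real mat" where
  "target_controllability_mat L B H =
     mat_of_cols (dim_row H) (concat (map (\<lambda>k. cols (H * (- L) ^\<^sub>m k * B)) [0..<dim_row L]))"

definition no_zero_rows :: "real mat \<Rightarrow> bool" where
  "no_zero_rows W \<longleftrightarrow> (\<forall>i<dim_row W. row W i \<noteq> 0\<^sub>v (dim_col W))"

definition reachable_from :: "nat pair_pre_digraph \<Rightarrow> nat set \<Rightarrow> nat \<Rightarrow> bool" where
  "reachable_from G S v \<longleftrightarrow> v \<in> S \<or> (\<exists>s\<in>S. s \<rightarrow>\<^sup>*\<^bsub>with_proj G\<^esub> v)"

end

theory Submission
  imports Defs
begin

text \<open>The matrix \<open>- L\<close> has nonnegative off-diagonal entries, positive exactly at the arcs.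
  Therefore the first power of \<open>- L\<close> whose \<open>(i, j)\<close> entry does not vanish is the one whose
  exponent is the distance from \<open>j\<close> to \<open>i\<close>, and this entry is positive: the negative diagonal
  only acts on entries that are still zero. As distances are below \<open>n\<close>, the nonzero rows of
  \<open>W\<close> are those of the reachable targets. For controllability, the nodes that no leader reaches
  form an autonomous linear subsystem, which stays at rest when started at \<open>0\<close>.\<close>

subsection \<open>Shortest walks and powers of matrices\<close>

text \<open>A walk of minimal length visits no vertex twice, since the piece between two visits
  could be cut out. Its \<open>k + 1\<close> vertices are thus distinct members of
  \<open>V\<close>.\<close>

lemma relpow_shortest:
  assumes "(x, y) \<in> R\<^sup>*" and "finite V" and "R \<subseteq> V \<times> V" and "x \<in> V"
  obtains k where "k < card V" and "(x, y) \<in> R ^^ k" and "\<And>m. m < k \<Longrightarrow> (x, y) \<notin> R ^^ m"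
proof -
  define k where "k = (LEAST k. (x, y) \<in> R ^^ k)"
  have k: "(x, y) \<in> R ^^ k"
    using assms(1) unfolding k_def rtrancl_power by (rule LeastI_ex)
  have least: "(x, y) \<notin> R ^^ m" if "m < k" for m
    using that not_less_Least unfolding k_def by blast
  from k obtain f where f: "f 0 = x" "f k = y" "\<And>i. i < k \<Longrightarrow> (f i, f (Suc i)) \<in> R"
    unfolding relpow_fun_conv by auto
  have seg: "(f a, f (a + d)) \<in> R ^^ d" if "a + d \<le> k" for a d
    using that by (induction d) (auto intro!: relcompI f(3))
  have "f a \<noteq> f b" if "a < b" "b \<le> k" for a b
  proof
    assume "f a = f b"
    moreover have "(x, f a) \<in> R ^^ a" "(f b, y) \<in> R ^^ (k - b)"
      using seg[of 0 a] seg[of b "k - b"] that f by auto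
    ultimately have "(x, y) \<in> R ^^ (a + (k - b))"
      unfolding relpow_add by auto
    moreover have "a + (k - b) < k" using that by linarith
    ultimately show False using least by blast
  qed
  then have "inj_on f {..k}"
    by (intro inj_onI) (metis atMost_iff linorder_neqE_nat)
  moreover have "f ` {..k} \<subseteq> V"
  proof safe
    fix i assume "i \<le> k"
    then show "f i \<in> V"
      using f(1) f(3)[of "i - 1"] assms(3,4) by (cases i) auto
  qed
  ultimately have "card {..k} \<le> card V"
    using card_inj_on_le assms(2) by blast
  then have "k < card V" by simp
  from that[OF this k least] show thesis .
qed

text \<open>The column index comes first, so that an entry \<open>(i, j)\<close> gives an arc from
  \<open>j\<close> to \<open>i\<close>. The diagonal would only add loops, which do not affect
  reachability.\<close>

definition mat_arcs :: "real mat \<Rightarrow> (nat \<times> nat) set" where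
  "mat_arcs M = {(j, i). i < dim_row M \<and> j < dim_col M \<and> i \<noteq> j \<and> M $$ (i, j) \<noteq> 0}"

lemma index_mult_mat_sum:
  assumes "A \<in> carrier_mat m n" and "C \<in> carrier_mat n p" and "i < m" and "j < p"
  shows "(A * C) $$ (i, j) = (\<Sum>k<n. A $$ (i, k) * C $$ (k, j))"
  using assms by (auto simp: scalar_prod_def lessThan_atLeast0)

text \<open>Only the first power that can be nonzero has a determined sign, because the diagonal of
  \<open>M\<close> is arbitrary.\<close>

lemma metzler_pow_entry:
  assumes M: "M \<in> carrier_mat n n"
    and off: "\<And>i j. \<lbrakk>i < n; j < n; i \<noteq> j\<rbrakk> \<Longrightarrow> M $$ (i, j) \<ge> 0"
    and "i < n" "j < n" and "\<And>m. m < k \<Longrightarrow> (j, i) \<notin> mat_arcs M ^^ m"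
  shows "(M ^\<^sub>m k) $$ (i, j) \<ge> 0 \<and> ((M ^\<^sub>m k) $$ (i, j) > 0 \<longleftrightarrow> (j, i) \<in> mat_arcs M ^^ k)"
  using assms(4-)
proof (induction k arbitrary: j)
  case 0
  then show ?case using M \<open>i < n\<close> by auto
next
  case (Suc k)
  let ?t = "\<lambda>m. (M ^\<^sub>m k) $$ (i, m) * M $$ (m, j)"
  have sum: "(M ^\<^sub>m Suc k) $$ (i, j) = (\<Sum>m<n. ?t m)"
    using index_mult_mat_sum[OF pow_carrier_mat[OF M] M \<open>i < n\<close> \<open>j < n\<close>] by simp
  have arc: "(j, m) \<in> mat_arcs M \<longleftrightarrow> M $$ (m, j) \<noteq> 0" if "m < n" "m \<noteq> j" for m
    using that M \<open>j < n\<close> by (auto simp: mat_arcs_def)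
  \<comment> \<open>The summand at \<open>m = j\<close> contains the diagonal entry of
    \<open>M\<close>, whose sign is unknown. Its other factor is zero by the induction hypothesis,
    because no walk of length \<open>k\<close> leads from \<open>j\<close> to
    \<open>i\<close>.\<close>
  have "(j, i) \<notin> mat_arcs M ^^ k" using Suc.prems(2) by simp
  with Suc.IH[of j] Suc.prems have diag: "(M ^\<^sub>m k) $$ (i, j) = 0"
    by force
  \<comment> \<open>The absence of shorter walks passes on to a successor \<open>m\<close> of
    \<open>j\<close>: a walk from \<open>m\<close> of length below \<open>k\<close>, prefixed by the
    arc, would be a walk from \<open>j\<close> of length below \<open>Suc k\<close>.\<close>
  have IH: "(M ^\<^sub>m k) $$ (i, m) \<ge> 0 \<and> ((M ^\<^sub>m k) $$ (i, m) > 0 \<longleftrightarrow> (m, i) \<in> mat_arcs M ^^ k)"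
    if "m < n" "(j, m) \<in> mat_arcs M" for m
    using Suc.IH[OF that(1)] that(2) Suc.prems(2) relpow_Suc_I2 by (metis Suc_mono)
  have t: "?t m \<ge> 0 \<and> (?t m > 0 \<longleftrightarrow> (j, m) \<in> mat_arcs M \<and> (m, i) \<in> mat_arcs M ^^ k)"
    if "m < n" for m
  proof (cases "(j, m) \<in> mat_arcs M")
    case True
    then have "m \<noteq> j" by (auto simp: mat_arcs_def)
    with True arc off \<open>j < n\<close> that have "M $$ (m, j) > 0" by force
    with IH[OF that True] True show ?thesis by (auto simp: zero_less_mult_iff)
  next
    case False
    with arc[OF that] diag have t0: "?t m = 0" by (cases "m = j") auto
    show ?thesis unfolding t0 using False by simp
  qed
  have "(\<Sum>m<n. ?t m) > 0 \<longleftrightarrow> (\<exists>m<n. ?t m > 0)"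
  proof
    assume "(\<Sum>m<n. ?t m) > 0"
    then show "\<exists>m<n. ?t m > 0"
      by (meson lessThan_iff not_less sum_nonpos)
  next
    assume "\<exists>m<n. ?t m > 0"
    then show "(\<Sum>m<n. ?t m) > 0"
      using t by (auto intro!: sum_pos2)
  qed
  also have "\<dots> \<longleftrightarrow> (\<exists>m<n. (j, m) \<in> mat_arcs M \<and> (m, i) \<in> mat_arcs M ^^ k)"
    using t by blast
  also have "\<dots> \<longleftrightarrow> (j, i) \<in> mat_arcs M ^^ Suc k"
  proof
    assume "(j, i) \<in> mat_arcs M ^^ Suc k"
    then obtain m where "(j, m) \<in> mat_arcs M" "(m, i) \<in> mat_arcs M ^^ k"
      by (rule relpow_Suc_E2)
    moreover have "m < n" using \<open>(j, m) \<in> mat_arcs M\<close> M by (auto simp: mat_arcs_def)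
    ultimately show "\<exists>m<n. (j, m) \<in> mat_arcs M \<and> (m, i) \<in> mat_arcs M ^^ k" by blast
  qed (blast intro: relpow_Suc_I2)
  finally show ?case
    unfolding sum using t by (auto intro!: sum_nonneg)
qed

text \<open>Without a walk, every exponent satisfies the hypothesis of
  \<open>metzler_pow_entry\<close>, so all powers vanish at \<open>(i, j)\<close>. With a walk, a
  shortest one has length below \<open>n\<close>, and the power with that exponent is positive
  there.\<close>

lemma metzler_pow_nonzero_iff:
  assumes M: "M \<in> carrier_mat n n"
    and off: "\<And>i j. \<lbrakk>i < n; j < n; i \<noteq> j\<rbrakk> \<Longrightarrow> M $$ (i, j) \<ge> 0"
    and "i < n" "j < n"
  shows "(\<exists>k<n. (M ^\<^sub>m k) $$ (i, j) \<noteq> 0) \<longleftrightarrow> (j, i) \<in> (mat_arcs M)\<^sup>*"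
proof
  assume "\<exists>k<n. (M ^\<^sub>m k) $$ (i, j) \<noteq> 0"
  then obtain k where k: "(M ^\<^sub>m k) $$ (i, j) \<noteq> 0" by blast
  show "(j, i) \<in> (mat_arcs M)\<^sup>*"
  proof (rule ccontr)
    assume "(j, i) \<notin> (mat_arcs M)\<^sup>*"
    then have "(j, i) \<notin> mat_arcs M ^^ m" for m by (auto simp: rtrancl_power)
    with metzler_pow_entry[OF M off \<open>i < n\<close> \<open>j < n\<close>, of k] k show False by auto
  qed
next
  assume r: "(j, i) \<in> (mat_arcs M)\<^sup>*"
  have "mat_arcs M \<subseteq> {..<n} \<times> {..<n}" using M by (auto simp: mat_arcs_def)
  with r \<open>j < n\<close> obtain k where "k < n" "(j, i) \<in> mat_arcs M ^^ k"
      "\<And>m. m < k \<Longrightarrow> (j, i) \<notin> mat_arcs M ^^ m"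
    using relpow_shortest[of j i "mat_arcs M" "{..<n}"] by auto
  with metzler_pow_entry[OF M off \<open>i < n\<close> \<open>j < n\<close>, of k]
  show "\<exists>k<n. (M ^\<^sub>m k) $$ (i, j) \<noteq> 0" by force
qed

subsection \<open>Uniqueness of the rest solution\<close>

text \<open>An exceptional point inside the interval splits it in two; continuity at that point lets
  the inequalities on both halves be chained.\<close>

lemma nonincreasing_except_finite:
  fixes f :: "real \<Rightarrow> real"
  assumes "finite D" and "a \<le> b" and "continuous_on {a..b} f"
    and "\<And>t. t \<in> {a<..<b} - D \<Longrightarrow> \<exists>y. (f has_real_derivative y) (at t) \<and> y \<le> 0"
  shows "f b \<le> f a"
  using assms
proof (induction D arbitrary: a b rule: finite_induct)
  case empty
  show ?case
    by (rule DERIV_nonpos_imp_decreasing_open) (use empty in auto)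
next
  case (insert d D)
  show ?case
  proof (cases "d \<in> {a<..<b}")
    case True
    have "f d \<le> f a"
      by (rule insert.IH) (use True insert.prems in \<open>auto elim: continuous_on_subset\<close>)
    moreover have "f b \<le> f d"
      by (rule insert.IH) (use True insert.prems in \<open>auto elim: continuous_on_subset\<close>)
    ultimately show ?thesis by simp
  next
    case False
    then show ?thesis using insert by auto
  qed
qed

text \<open>The energy \<open>\<Sum>i\<in>U. x i t\<^sup>2\<close> grows at most exponentially, so it stays zero.\<close>

lemma linear_system_rest:
  fixes x :: "'i \<Rightarrow> real \<Rightarrow> real" and A :: "'i \<Rightarrow> 'i \<Rightarrow> real"
  assumes "finite U" and "finite D" and "a \<le> b"
    and cont: "\<And>i. i \<in> U \<Longrightarrow> continuous_on {a..b} (x i)"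
    and deriv: "\<And>i t. \<lbrakk>i \<in> U; t \<in> {a<..<b} - D\<rbrakk> \<Longrightarrow>
      (x i has_real_derivative (\<Sum>k\<in>U. A i k * x k t)) (at t)"
    and init: "\<And>i. i \<in> U \<Longrightarrow> x i a = 0"
    and "i \<in> U"
  shows "x i b = 0"
proof -
  define V where "V t = (\<Sum>i\<in>U. (x i t)\<^sup>2)" for t
  \<comment> \<open>Each product \<open>x i t * x k t\<close> is at most \<open>V t\<close> in
    absolute value, so this constant times \<open>V t\<close> bounds the double sum
    \<open>V' t\<close>, the derivative of \<open>V\<close> along the system.\<close>
  define C where "C = 2 * (\<Sum>i\<in>U. \<Sum>k\<in>U. \<bar>A i k\<bar>)"
  define V' where "V' t = (\<Sum>i\<in>U. 2 * x i t * (\<Sum>k\<in>U. A i k * x k t))" for t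
  have sq: "(x i t)\<^sup>2 \<le> V t" if "i \<in> U" for i t
    unfolding V_def using that \<open>finite U\<close> by (intro member_le_sum) auto
  have V'_le: "V' t \<le> C * V t" for t
  proof -
    have "x i t * (A i k * x k t) \<le> \<bar>A i k\<bar> * V t" if "i \<in> U" "k \<in> U" for i k
    proof -
      \<comment> \<open>Expanding the square bounds twice the absolute product by the sum of the two
        squares, each of which is at most \<open>V t\<close>.\<close>
      have "0 \<le> (\<bar>x i t\<bar> - \<bar>x k t\<bar>)\<^sup>2" by simp
      then have "\<bar>x i t * x k t\<bar> \<le> V t"
        using sq[OF that(1), of t] sq[OF that(2), of t]
        by (simp add: power2_diff abs_mult)
      then have "\<bar>A i k\<bar> * \<bar>x i t * x k t\<bar> \<le> \<bar>A i k\<bar> * V t"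
        by (intro mult_left_mono) auto
      moreover have "x i t * (A i k * x k t) \<le> \<bar>A i k\<bar> * \<bar>x i t * x k t\<bar>"
        using abs_ge_self[of "x i t * (A i k * x k t)"] by (simp add: abs_mult mult_ac)
      ultimately show ?thesis by linarith
    qed
    then have "(\<Sum>i\<in>U. \<Sum>k\<in>U. x i t * (A i k * x k t)) \<le> (\<Sum>i\<in>U. \<Sum>k\<in>U. \<bar>A i k\<bar> * V t)"
      by (intro sum_mono)
    then show ?thesis
      unfolding V'_def C_def
      by (simp add: sum_distrib_left sum_distrib_right mult.assoc flip: sum_distrib_left)
  qed
  \<comment> \<open>The integrating factor of Gronwall's inequality: it turns
    \<open>V' t \<le> C * V t\<close> into a nonpositive derivative of \<open>F\<close>.\<close>
  define F where "F t = exp (- C * t) * V t" for t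
  have "F b \<le> F a"
  proof (rule nonincreasing_except_finite[OF \<open>finite D\<close> \<open>a \<le> b\<close>])
    show "continuous_on {a..b} F"
      unfolding F_def V_def by (intro continuous_intros cont)
    fix t assume t: "t \<in> {a<..<b} - D"
    have "(V has_real_derivative V' t) (at t)"
      unfolding V_def V'_def
      by (rule DERIV_sum) (use deriv[OF _ t] in \<open>auto intro!: derivative_eq_intros\<close>)
    then have "(F has_real_derivative exp (- C * t) * (V' t - C * V t)) (at t)"
      unfolding F_def by (auto intro!: derivative_eq_intros simp: algebra_simps)
    moreover have "exp (- C * t) * (V' t - C * V t) \<le> 0"
      using V'_le[of t] by (simp add: mult_le_0_iff)
    ultimately show "\<exists>y. (F has_real_derivative y) (at t) \<and> y \<le> 0" by blast
  qed
  also have "F a = 0" using init by (simp add: F_def V_def)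
  finally have "V b \<le> 0" by (simp add: F_def mult_le_0_iff)
  with sq[OF \<open>i \<in> U\<close>, of b] have "(x i b)\<^sup>2 \<le> 0" by linarith
  then show ?thesis by simp
qed

subsection \<open>The multiagent system\<close>

text \<open>The two notions of reachability can differ only at walks of length 0, which
  \<open>\<rightarrow>\<^sup>*\<close> allows at vertices alone;
  \<open>S \<subseteq> pverts G\<close> settles this case. Reflexivity of the closure absorbs the
  disjunct \<open>v \<in> S\<close>.\<close>

lemma reachable_from_iff:
  assumes "pair_wf_digraph G" and "S \<subseteq> pverts G"
  shows "reachable_from G S v \<longleftrightarrow> (\<exists>s\<in>S. (s, v) \<in> (parcs G)\<^sup>*)"
proof -
  interpret pair_wf_digraph G by fact
  have "s \<rightarrow>\<^sup>*\<^bsub>with_proj G\<^esub> v \<longleftrightarrow> (s, v) \<in> (parcs G)\<^sup>*" if "s \<in> S" for s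
  proof
    assume "(s, v) \<in> (parcs G)\<^sup>*"
    then show "s \<rightarrow>\<^sup>*\<^bsub>with_proj G\<^esub> v"
    proof induction
      case base
      then show ?case using that assms(2) by auto
    next
      case (step y z)
      then show ?case using reachable_adj_trans by auto
    qed
  qed (use reachable_rtranclI in auto)
  then show ?thesis unfolding reachable_from_def by blast
qed

lemma laplacian_carrier: "laplacian n G w \<in> carrier_mat n n"
  by (simp add: laplacian_def)

text \<open>Off the diagonal, the negated Laplacian carries the weights, which are nonzero exactly
  at the arcs; as there are no loops, every arc lies off the diagonal.\<close>

lemma mat_arcs_laplacian:
  assumes "pair_digraph G" and "pverts G = {..<n}"
    and "\<And>i j. (j, i) \<in> parcs G \<Longrightarrow> w i j > 0"
  shows "mat_arcs (- laplacian n G w) = parcs G"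
proof -
  interpret pair_digraph G by fact
  have "j < n \<and> i < n \<and> i \<noteq> j" if "(j, i) \<in> parcs G" for i j
    using arc_fst_in_verts[OF that] arc_snd_in_verts[OF that] pair_no_loops[OF that] assms(2)
    by auto
  with assms(3) show ?thesis
    by (force simp: mat_arcs_def laplacian_def adj_weight_def split: if_splits)
qed

lemma row_mat_of_cols_eq_0_iff:
  assumes "i < n" and "set vs \<subseteq> carrier_vec n"
  shows "row (mat_of_cols n vs) i = 0\<^sub>v (length vs) \<longleftrightarrow> (\<forall>v\<in>set vs. v $ i = 0)"
  using assms by (auto simp: vec_eq_iff mat_of_cols_index all_set_conv_all_nth)

lemma index_target_mult:
  assumes "A \<in> carrier_mat n m" and "i < length ts" and "set ts \<subseteq> {..<n}" and "j < m"
  shows "(target_mat n ts * A) $$ (i, j) = A $$ (ts ! i, j)"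
proof -
  have "ts ! i < n" using assms(2,3) nth_mem by blast
  then show ?thesis
    using assms by (simp add: target_mat_def)
qed

lemma index_mult_leader:
  assumes "A \<in> carrier_mat m n" and "i < m" and "j < length ls" and "set ls \<subseteq> {..<n}"
  shows "(A * leader_mat n ls) $$ (i, j) = A $$ (i, ls ! j)"
proof -
  have "ls ! j < n" using assms(3,4) nth_mem by blast
  then show ?thesis
    using assms by (simp add: leader_mat_def)
qed

text \<open>The factor \<open>target_mat n ts\<close> selects the rows of the targets and
  \<open>leader_mat n ls\<close> the columns of the leaders. Hence the row of a target
  \<open>v\<close> lists the entries at \<open>(v, s)\<close> of the powers with exponents below
  \<open>n\<close>.\<close>

lemma no_zero_rows_iff:
  assumes L: "L \<in> carrier_mat n n" and ls: "set ls \<subseteq> {..<n}" and ts: "set ts \<subseteq> {..<n}"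
  shows "no_zero_rows (target_controllability_mat L (leader_mat n ls) (target_mat n ts)) \<longleftrightarrow>
    (\<forall>v\<in>set ts. \<exists>s\<in>set ls. \<exists>k<n. ((- L) ^\<^sub>m k) $$ (v, s) \<noteq> 0)"
proof -
  let ?B = "leader_mat n ls" and ?H = "target_mat n ts" and ?p = "length ts"
  let ?P = "\<lambda>k. (- L) ^\<^sub>m k"
  let ?vs = "concat (map (\<lambda>k. cols (?H * ?P k * ?B)) [0..<n])"
  have B: "?B \<in> carrier_mat n (length ls)" and H: "?H \<in> carrier_mat ?p n"
    by (auto simp: leader_mat_def target_mat_def)
  have P: "?P k \<in> carrier_mat n n" for k using L by auto
  have HPB: "?H * ?P k * ?B \<in> carrier_mat ?p (length ls)" for k
    using H P B by (meson mult_carrier_mat)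
  have W: "target_controllability_mat L ?B ?H = mat_of_cols ?p ?vs"
    using L H by (simp add: target_controllability_mat_def)
  have vs: "set ?vs \<subseteq> carrier_vec ?p"
    using H by (auto dest!: subsetD[OF cols_dim])
  have entry: "(?H * ?P k * ?B) $$ (i, j) = ?P k $$ (ts ! i, ls ! j)"
    if "i < ?p" "j < length ls" for i j k
  proof -
    have "ls ! j < n" using that ls nth_mem by blast
    then show ?thesis
      using that ls ts
        index_mult_leader[of "?H * ?P k" ?p n i j ls]
        index_target_mult[of "?P k" n n i ts "ls ! j"] P[of k] H by auto
  qed
  have row: "row (mat_of_cols ?p ?vs) i = 0\<^sub>v (length ?vs) \<longleftrightarrow>
      (\<forall>s\<in>set ls. \<forall>k<n. ?P k $$ (ts ! i, s) = 0)" if "i < ?p" for i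
  proof -
    have "row (mat_of_cols ?p ?vs) i = 0\<^sub>v (length ?vs) \<longleftrightarrow>
        (\<forall>k<n. \<forall>j<length ls. col (?H * ?P k * ?B) j $ i = 0)"
      unfolding row_mat_of_cols_eq_0_iff[OF that vs] using B by (auto simp: cols_def)
    also have "\<dots> \<longleftrightarrow> (\<forall>k<n. \<forall>j<length ls. ?P k $$ (ts ! i, ls ! j) = 0)"
      using entry[OF that] HPB B H that by (auto simp del: index_mult_mat(1))
    finally show ?thesis by (auto simp: all_set_conv_all_nth)
  qed
  show ?thesis
    unfolding W no_zero_rows_def mat_of_cols_carrier all_set_conv_all_nth[of ts]
    using row by blast
qed

text \<open>Started at rest, the subsystem on the unreachable nodes never moves, so the output
  \<open>(1, \<dots>, 1)\<close> is out of reach.\<close>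

lemma target_controllable_imp_reachable:
  assumes L: "L \<in> carrier_mat n n" and ls: "set ls \<subseteq> {..<n}" and ts: "set ts \<subseteq> {..<n}"
    and ctrl: "target_controllable t0 L (leader_mat n ls) (target_mat n ts)"
    and "v \<in> set ts"
  shows "\<exists>s\<in>set ls. (s, v) \<in> (mat_arcs (- L))\<^sup>*"
proof (rule ccontr)
  assume unreach: "\<not> ?thesis"
  let ?B = "leader_mat n ls" and ?H = "target_mat n ts" and ?p = "length ts"
  define U where "U = {i. i < n \<and> \<not> (\<exists>s\<in>set ls. (s, i) \<in> (mat_arcs (- L))\<^sup>*)}"
  have "finite U" "U \<subseteq> {..<n}" by (auto simp: U_def)
  have "v \<in> U" using unreach \<open>v \<in> set ts\<close> ts by (auto simp: U_def)
  have dims: "dim_row L = n" "dim_col ?B = length ls" "dim_row ?B = n" "dim_row ?H = ?p"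
    using L by (auto simp: leader_mat_def target_mat_def)
  obtain tf u x where "t0 < tf" and tr: "trajectory L ?B t0 tf u x"
    and x0: "x t0 = 0\<^sub>v n" and y: "?H *\<^sub>v x tf = vec ?p (\<lambda>_. 1)"
    using ctrl unfolding target_controllable_def dims
    by (metis vec_carrier zero_carrier_vec)
  obtain D where "finite D" and
    deriv: "\<And>t i. \<lbrakk>t \<in> {t0<..<tf} - D; i < n\<rbrakk> \<Longrightarrow>
      ((\<lambda>s. x s $ i) has_real_derivative (- L *\<^sub>v x t + ?B *\<^sub>v u t) $ i) (at t)"
    using tr unfolding trajectory_def dims by blast
  have carr: "u t \<in> carrier_vec (length ls)" "x t \<in> carrier_vec n" if "t \<in> {t0..tf}" for t
    using tr that unfolding trajectory_def dims by auto
  \<comment> \<open>An arc into \<open>U\<close> from a node outside \<open>U\<close> would prolong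
    a walk that starts at a leader.\<close>
  have closed: "L $$ (i, k) = 0" if "i \<in> U" "k < n" "k \<notin> U" for i k
  proof (rule ccontr)
    assume "L $$ (i, k) \<noteq> 0"
    with that L have "(k, i) \<in> mat_arcs (- L)" by (auto simp: mat_arcs_def U_def)
    with that show False by (auto simp: U_def intro: rtrancl_into_rtrancl)
  qed
  \<comment> \<open>Every leader reaches itself and so lies outside \<open>U\<close>; hence row
    \<open>i\<close> of \<open>?B\<close> is zero and the input drops out. By \<open>closed\<close>,
    the state term involves only nodes of \<open>U\<close>.\<close>
  have rhs: "(- L *\<^sub>v x t + ?B *\<^sub>v u t) $ i = (\<Sum>k\<in>U. - L $$ (i, k) * x t $ k)"
    if "t \<in> {t0..tf}" "i \<in> U" for t i
  proof -
    have "i < n" using that by (simp add: U_def)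
    have "ls ! j < n" "i \<noteq> ls ! j" if "j < length ls" for j
      using \<open>i \<in> U\<close> ls nth_mem[OF that] by (auto simp: U_def)
    then have "(?B *\<^sub>v u t) $ i = 0"
      using \<open>i < n\<close> carr[OF that(1)]
      by (auto simp: leader_mat_def scalar_prod_def mat_of_cols_index intro!: sum.neutral)
    moreover have "(- L *\<^sub>v x t) $ i = (\<Sum>k<n. - L $$ (i, k) * x t $ k)"
      using \<open>i < n\<close> carr[OF that(1)] L
      by (auto simp: scalar_prod_def lessThan_atLeast0 sum_negf)
    moreover have "\<dots> = (\<Sum>k\<in>U. - L $$ (i, k) * x t $ k)"
      using \<open>U \<subseteq> {..<n}\<close> closed[OF that(2)] by (intro sum.mono_neutral_right) auto
    ultimately show ?thesis using \<open>i < n\<close> dims by simp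
  qed
  have "x tf $ v = 0"
  proof (rule linear_system_rest[where x = "\<lambda>i t. x t $ i" and A = "\<lambda>i k. - L $$ (i, k)"])
    show "continuous_on {t0..tf} (\<lambda>t. x t $ i)" if "i \<in> U" for i
      using tr that unfolding trajectory_def dims by (auto simp: U_def)
    show "((\<lambda>t. x t $ i) has_real_derivative (\<Sum>k\<in>U. - L $$ (i, k) * x t $ k)) (at t)"
      if "i \<in> U" "t \<in> {t0<..<tf} - D" for i t
      using deriv[OF that(2), of i] rhs[of t i] that by (auto simp: U_def)
    show "x t0 $ i = 0" if "i \<in> U" for i
      using that x0 by (simp add: U_def)
  qed (use \<open>finite U\<close> \<open>finite D\<close> \<open>t0 < tf\<close> \<open>v \<in> U\<close> in auto)
  moreover obtain i where i: "i < ?p" "v = ts ! i"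
    using \<open>v \<in> set ts\<close> by (auto simp: in_set_conv_nth)
  moreover have "(?H *\<^sub>v x tf) $ i = x tf $ v"
    using i \<open>v \<in> U\<close> carr(2)[of tf] \<open>t0 < tf\<close> by (simp add: target_mat_def U_def)
  ultimately show False using y by simp
qed

theorem proposition1:
  fixes n :: nat and G :: "nat pair_pre_digraph" and w :: "nat \<Rightarrow> nat \<Rightarrow> real"
    and ls ts :: "nat list" and t0 :: real and L B H :: "real mat"
  assumes "pair_digraph G" and "pverts G = {..<n}"
    and "\<And>i j. (j, i) \<in> parcs G \<Longrightarrow> w i j > 0"
    and "distinct ls" and "set ls \<subseteq> pverts G"
    and "distinct ts" and "set ts \<subseteq> pverts G"
  defines "L \<equiv> laplacian n G w" and "B \<equiv> leader_mat n ls" and "H \<equiv> target_mat n ts"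
  shows "(target_controllable t0 L B H \<longrightarrow> (\<forall>v\<in>set ts. reachable_from G (set ls) v)) \<and>
    ((\<forall>v\<in>set ts. reachable_from G (set ls) v) \<longleftrightarrow>
      no_zero_rows (target_controllability_mat L B H))"
proof -
  have L: "L \<in> carrier_mat n n" unfolding L_def by (rule laplacian_carrier)
  have ls: "set ls \<subseteq> {..<n}" and ts: "set ts \<subseteq> {..<n}" using assms by auto
  have arcs: "mat_arcs (- L) = parcs G"
    unfolding L_def using assms(1-3) by (rule mat_arcs_laplacian)
  have reach: "reachable_from G (set ls) v \<longleftrightarrow> (\<exists>s\<in>set ls. (s, v) \<in> (mat_arcs (- L))\<^sup>*)" for v
    unfolding arcs using assms(1,5)
    by (intro reachable_from_iff) (auto simp: pair_digraph_def pair_fin_digraph_def)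
  \<comment> \<open>Positivity of the weights enters twice: here as the sign of the off-diagonal
    entries of \<open>- L\<close>, and in \<open>arcs\<close> as their being nonzero at every
    arc.\<close>
  have off: "(- L) $$ (i, j) \<ge> 0" if "i < n" "j < n" "i \<noteq> j" for i j
    using that assms(3)[of j i] by (auto simp: L_def laplacian_def adj_weight_def)
  have "(\<exists>k<n. ((- L) ^\<^sub>m k) $$ (v, s) \<noteq> 0) \<longleftrightarrow> (s, v) \<in> (mat_arcs (- L))\<^sup>*"
    if "v \<in> set ts" "s \<in> set ls" for v s
    using that ls ts L off by (intro metzler_pow_nonzero_iff) auto
  then have "(\<forall>v\<in>set ts. reachable_from G (set ls) v) \<longleftrightarrow>
      no_zero_rows (target_controllability_mat L B H)"
    unfolding reach B_def H_def no_zero_rows_iff[OF L ls ts] by blast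
  moreover have "\<forall>v\<in>set ts. reachable_from G (set ls) v" if "target_controllable t0 L B H"
    using target_controllable_imp_reachable[OF L ls ts that[unfolded B_def H_def]] reach by blast
  ultimately show ?thesis by blast
qed

end
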